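(* Let $\lambda=(\lambda_1,\ldots,\lambda_n)$ be a partition, set $m=\lambda_1$, and let $\alpha\in\mathbb N^n$. If $\alpha=0^n$, then $\alpha^\lambda=0^m$. Otherwise, write $\operatorname{supp}(\alpha)=\{i:\alpha_i\neq 0\}=\{i_1<\cdots<i_c\}$. Then $\alpha^\lambda$ exists if and only if $$\lambda[i_j]\ge c-j+1\qquad(1\le j\le c).$$ Equivalently, $$\min_{1\le j\le c}\{\lambda[i_j]-(c-j)\}\ge 1.$$
   Context: $\mathbb N=\{0,1,2,\ldots\}$. For a weak composition $\alpha$, $\alpha^+$ is its weakly decreasing rearrangement and $K(\alpha)$ is the key tableau: the semistandard tableau (English notation) of shape $\alpha^+$ and content $\alpha$, whose column $r$ consists of $\{i:\alpha_i\ge r\}$. Partitions may be padded with trailing zeros; write $\lambda[i]=\lambda_i$. For $\alpha\in\mathbb N^n$, $B_+^\lambda(\alpha)$ is the filling of shape $\alpha^+$ such that, if column $r$ has length $c_r$, its $i$-th entry from the top is $\lambda[\,\cdot\,]$ applied to the $(c_r+1-i)$-th entry from the top of column $r$ of $K(\alpha)$. For a weakly increasing integer column written from bottom to top as $c_1\ge\cdots\ge c_k$, its strictification is the column $d_1>\cdots>d_k$ (bottom to top) with $d_1=c_1$, $d_i=\min\{d_{i-1}-1,c_i\}$. If the columnwise strictification $\operatorname{str}(B_+^\lambda(\alpha))$ has only positive entries (vacuously true if $\alpha=0$), it is a key tableau and $\alpha^\lambda\in\mathbb N^m$ is the unique weak composition with $K(\alpha^\lambda)=\operatorname{str}(B_+^\lambda(\alpha))$;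 otherwise (the strictification contains a nonpositive entry) we say that $\alpha^\lambda$ does not exist. *)

theory Defs
  imports Main
begin

section \<open>Weak compositions and key tableaux\<close>

text \<open>
  Weak compositions in \<open>\<nat>\<^sup>n\<close> and partitions with \<open>n\<close> (possibly zero) parts are lists of length \<open>n\<close>;
  \<open>part xs i\<close> is the 1-based \<open>i\<close>-th part, where the list is padded with zeros.
\<close>

definition part :: "nat list \<Rightarrow> nat \<Rightarrow> nat" where
  "part xs i = (if 1 \<le> i \<and> i \<le> length xs then xs ! (i - 1) else 0)"

definition partition_of_length :: "nat \<Rightarrow> nat list \<Rightarrow> bool" where
  "partition_of_length n lam \<longleftrightarrow> length lam = n \<and> sorted_wrt (\<ge>) lam"

definition supp :: "nat list \<Rightarrow> nat set" where
  "supp \<alpha> = {i \<in> {1..length \<alpha>}. part \<alpha> i \<noteq> 0}"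

definition rearr :: "nat list \<Rightarrow> nat list" where
  "rearr \<alpha> = rev (sort \<alpha>)"

text \<open>
  A filling of a Young diagram in English notation is the list of its columns from left to right,
  each column being the list of its entries from top to bottom.
\<close>

definition key_column :: "nat list \<Rightarrow> nat \<Rightarrow> nat list" where
  "key_column \<alpha> r = filter (\<lambda>i. r \<le> part \<alpha> i) [1..<Suc (length \<alpha>)]"

definition key_tableau :: "nat list \<Rightarrow> nat list list" where
  "key_tableau \<alpha> = map (key_column \<alpha>) [1..<Suc (part (rearr \<alpha>) 1)]"

definition B_plus :: "nat list \<Rightarrow> nat list \<Rightarrow> int list list" where
  "B_plus lam \<alpha> = map (\<lambda>col. map (\<lambda>i. int (part lam i)) (rev col)) (key_tableau \<alpha>)"

text \<open>\<open>strict_from d cs\<close> strictifies \<open>cs\<close>, read from bottom to top, above an entry \<open>d\<close>.\<close>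

primrec strict_from :: "int \<Rightarrow> int list \<Rightarrow> int list" where
  "strict_from d [] = []"
| "strict_from d (c # cs) = min (d - 1) c # strict_from (min (d - 1) c) cs"

primrec strict_up :: "int list \<Rightarrow> int list" where
  "strict_up [] = []"
| "strict_up (c # cs) = c # strict_from c cs"

definition str_column :: "int list \<Rightarrow> int list" where
  "str_column col = rev (strict_up (rev col))"

definition str :: "int list list \<Rightarrow> int list list" where
  "str T = map str_column T"

text \<open>
  \<open>comp_pow lam \<alpha>\<close> is the weak composition \<open>\<alpha>\<^sup>\<lambda>\<close>, and \<open>None\<close> if it does not exist.
  Lemma \<open>comp_pow_well_defined\<close> below justifies the definite description.
\<close>

definition comp_pow :: "nat list \<Rightarrow> nat list \<Rightarrow> nat list option" where
  "comp_pow lam \<alpha> =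
    (if \<forall>col \<in> set (str (B_plus lam \<alpha>)). \<forall>x \<in> set col. 0 < x
     then Some (THE \<beta>. length \<beta> = part lam 1 \<and>
                       map (map int) (key_tableau \<beta>) = str (B_plus lam \<alpha>))
     else None)"


section \<open>The key tableau is semistandard of shape \<open>\<alpha>\<^sup>+\<close> and content \<open>\<alpha>\<close>\<close>

lemma set_key_column: "set (key_column \<alpha> r) = {i \<in> {1..length \<alpha>}. r \<le> part \<alpha> i}"
  by (auto simp: key_column_def)

lemma key_column_strict: "sorted_wrt (<) (key_column \<alpha> r)"
  by (simp add: key_column_def sorted_wrt_filter del: upt_Suc)

lemma key_column_filter:
  assumes "r \<le> s"
  shows "key_column \<alpha> s = filter (\<lambda>i. s \<le> part \<alpha> i) (key_column \<alpha> r)"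
  using assms by (auto simp: key_column_def simp del: upt_Suc intro!: filter_cong)

lemma part_decreasing:
  assumes "sorted_wrt (\<ge>) xs" "1 \<le> i" "i \<le> j"
  shows "part xs j \<le> part xs i"
proof (cases "i = j \<or> j > length xs")
  case False
  then have "xs ! (i - 1) \<ge> xs ! (j - 1)"
    using assms by (intro sorted_wrt_nth_less[OF assms(1)]) auto
  then show ?thesis using False assms by (auto simp: part_def)
qed (use assms in \<open>auto simp: part_def\<close>)

lemma sorted_rearr: "sorted_wrt (\<ge>) (rearr \<alpha>)"
  by (simp add: rearr_def sorted_wrt_rev)

lemma part_le_length_filter:
  assumes "sorted_wrt (\<ge>) xs" "1 \<le> j" "1 \<le> r"
  shows "j \<le> length (filter ((\<le>) r) xs) \<longleftrightarrow> r \<le> part xs j"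
  using assms
proof (induction xs arbitrary: j)
  case Nil
  then show ?case by (simp add: part_def)
next
  case (Cons x xs)
  show ?case
  proof (cases "r \<le> x")
    case True
    show ?thesis
    proof (cases "j = 1")
      case True
      then show ?thesis using \<open>r \<le> x\<close> by (simp add: part_def)
    next
      case False
      then have "part (x # xs) j = part xs (j - 1)"
        using Cons.prems by (auto simp: part_def nth_Cons')
      then show ?thesis
        using Cons.IH[of "j - 1"] Cons.prems False \<open>r \<le> x\<close>
        by (simp add: Suc_le_eq) linarith
    qed
  next
    case False
    then have *: "y < r" if "y \<in> set (x # xs)" for y using that Cons.prems by auto
    then have "filter ((\<le>) r) (x # xs) = []" by (force simp: filter_empty_conv simp del: filter.simps dest: *)
    moreover have "part (x # xs) j < r"
      using * Cons.prems by (auto simp: part_def simp del: nth_Cons_Suc intro!: * nth_mem)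
    ultimately show ?thesis using Cons.prems by simp
  qed
qed

lemma length_key_column: "length (key_column \<alpha> r) = length (filter ((\<le>) r) (rearr \<alpha>))"
proof -
  have "map (part \<alpha>) [1..<Suc (length \<alpha>)] = \<alpha>"
    by (rule nth_equalityI) (auto simp: part_def simp del: upt_Suc)
  then have "length (key_column \<alpha> r) = length (filter ((\<le>) r) \<alpha>)"
    by (metis (no_types, lifting) comp_apply filter_cong filter_map key_column_def length_map)
  then show ?thesis
    by (simp add: rearr_def filter_sort flip: rev_filter)
qed

lemma length_key_column_ge:
  assumes "1 \<le> j" "1 \<le> r"
  shows "j \<le> length (key_column \<alpha> r) \<longleftrightarrow> r \<le> part (rearr \<alpha>) j"
  using part_le_length_filter[OF sorted_rearr assms] by (simp add: length_key_column)

lemma length_filter_upt_le: "length (filter (\<lambda>r. r \<le> k) [1..<Suc n]) = min k n"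
  by (induction n) auto

lemma key_tableau_shape:
  assumes "1 \<le> j"
  shows "length (filter (\<lambda>col. j \<le> length col) (key_tableau \<alpha>)) = part (rearr \<alpha>) j"
proof -
  let ?M = "part (rearr \<alpha>) 1"
  have "length (filter (\<lambda>col. j \<le> length col) (key_tableau \<alpha>)) =
      length (filter (\<lambda>r. j \<le> length (key_column \<alpha> r)) [1..<Suc ?M])"
    by (simp add: key_tableau_def filter_map o_def del: upt_Suc)
  also have "filter (\<lambda>r. j \<le> length (key_column \<alpha> r)) [1..<Suc ?M] =
      filter (\<lambda>r. r \<le> part (rearr \<alpha>) j) [1..<Suc ?M]"
    using assms by (intro filter_cong) (auto simp: length_key_column_ge simp del: upt_Suc)
  also have "length \<dots> = part (rearr \<alpha>) j"
    using part_decreasing[OF sorted_rearr order_refl assms] by (simp only: length_filter_upt_le) simp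
  finally show ?thesis .
qed

lemma filter_nth_ge:
  assumes "sorted xs" "j < length (filter P xs)"
  shows "xs ! j \<le> filter P xs ! j"
  using assms
proof (induction xs arbitrary: j)
  case (Cons x xs)
  show ?case
  proof (cases "P x")
    case True
    then show ?thesis using Cons by (cases j) auto
  next
    case False
    have "j < length xs"
      using Cons.prems False length_filter_le[of P xs] by (simp add: less_le_trans)
    then have "(x # xs) ! j \<le> xs ! j"
      using Cons.prems by (cases j) (auto simp: sorted_nth_mono sorted_iff_nth_mono_less)
    then show ?thesis using Cons False by fastforce
  qed
qed simp

lemma key_tableau_rows:
  assumes "r \<le> s" "s < length (key_tableau \<alpha>)" "j < length (key_tableau \<alpha> ! s)"
  shows "key_tableau \<alpha> ! r ! j \<le> key_tableau \<alpha> ! s ! j"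
proof -
  have eq: "key_tableau \<alpha> ! t = key_column \<alpha> (Suc t)" if "t < length (key_tableau \<alpha>)" for t
    using that by (simp add: key_tableau_def del: upt_Suc)
  have "sorted (key_column \<alpha> (Suc r))"
    using key_column_strict strict_sorted_imp_sorted by blast
  then show ?thesis
    using assms filter_nth_ge[of "key_column \<alpha> (Suc r)" j "\<lambda>i. Suc s \<le> part \<alpha> i"]
    by (simp add: eq key_column_filter[of "Suc r" "Suc s"])
qed

lemma key_tableau_columns:
  "col \<in> set (key_tableau \<alpha>) \<Longrightarrow> sorted_wrt (<) col"
  by (auto simp: key_tableau_def key_column_strict simp del: upt_Suc)

lemma part_le_rearr: "part \<alpha> i \<le> part (rearr \<alpha>) 1"
proof (cases "part \<alpha> i = 0")
  case False
  then have "i \<in> set (key_column \<alpha> (part \<alpha> i))"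
    by (auto simp: set_key_column part_def split: if_splits)
  then have "1 \<le> length (key_column \<alpha> (part \<alpha> i))"
    by (cases "key_column \<alpha> (part \<alpha> i)") auto
  then show ?thesis using False by (subst (asm) length_key_column_ge) auto
qed simp

lemma count_list_distinct: "distinct xs \<Longrightarrow> count_list xs x = (if x \<in> set xs then 1 else 0)"
  by (induction xs) auto

lemma key_tableau_content:
  assumes "1 \<le> i"
  shows "count_list (concat (key_tableau \<alpha>)) i = part \<alpha> i"
proof -
  have *: "count_list (concat (map (key_column \<alpha>) rs)) i =
      length (filter (\<lambda>r. r \<le> part \<alpha> i) rs)" if "\<forall>r\<in>set rs. 1 \<le> r" for rs
    using that
  proof (induction rs)
    case (Cons r rs)
    have "distinct (key_column \<alpha> r)" by (simp add: key_column_def del: upt_Suc)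
    moreover have "i \<in> set (key_column \<alpha> r) \<longleftrightarrow> r \<le> part \<alpha> i"
      using Cons.prems assms by (auto simp: set_key_column part_def)
    ultimately show ?case using Cons by (auto simp: count_list_distinct)
  qed simp
  have "count_list (concat (key_tableau \<alpha>)) i = min (part \<alpha> i) (part (rearr \<alpha>) 1)"
    unfolding key_tableau_def by (subst *) (auto simp only: length_filter_upt_le set_upt, auto)
  then show ?thesis using part_le_rearr[of \<alpha> i] by simp
qed


section \<open>Well-definedness of \<open>\<alpha>\<^sup>\<lambda>\<close>\<close>

lemma part_ext:
  assumes "length \<beta> = length \<gamma>" "\<And>i. 1 \<le> i \<Longrightarrow> part \<beta> i = part \<gamma> i"
  shows "\<beta> = \<gamma>"
proof (rule nth_equalityI[OF assms(1)])
  fix i assume "i < length \<beta>"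
  then show "\<beta> ! i = \<gamma> ! i" using assms(2)[of "Suc i"] assms(1) by (simp add: part_def)
qed

lemma key_tableau_inj:
  assumes "length \<beta> = length \<gamma>" "key_tableau \<beta> = key_tableau \<gamma>"
  shows "\<beta> = \<gamma>"
  using assms by (intro part_ext) (auto simp flip: key_tableau_content)

lemma strict_from_less: "x \<in> set (strict_from d cs) \<Longrightarrow> x < d"
  by (induction cs arbitrary: d) force+

lemma strict_from_le:
  "\<forall>c \<in> set cs. c \<le> b \<Longrightarrow> x \<in> set (strict_from d cs) \<Longrightarrow> x \<le> b"
  by (induction cs arbitrary: d) auto

lemma strict_from_decreasing: "sorted_wrt (>) (strict_from d cs)"
  by (induction cs arbitrary: d) (auto dest: strict_from_less)

lemma length_strict_from: "length (strict_from d cs) = length cs"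
  by (induction cs arbitrary: d) auto

lemma strict_from_filter:
  assumes "sorted_wrt (\<ge>) (map f zs)" "e \<le> d"
  shows "set (strict_from d (map f (filter P zs))) \<subseteq> set (strict_from e (map f zs)) \<union> {e..<d}"
  using assms
proof (induction zs arbitrary: d e)
  case (Cons z zs)
  let ?x = "f z"
  let ?e = "min (e - 1) ?x"
  show ?case
  proof (cases "P z")
    case True
    let ?d = "min (d - 1) ?x"
    have "set (strict_from ?d (map f (filter P zs))) \<subseteq>
        set (strict_from ?e (map f zs)) \<union> {?e..<?d}"
      using Cons.prems by (intro Cons.IH) auto
    moreover have "insert ?d {?e..<?d} \<subseteq> insert ?e {e..<d}"
      using Cons.prems by auto
    ultimately show ?thesis using True by auto
  next
    case False
    have "set (strict_from d (map f (filter P zs))) \<subseteq>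
        set (strict_from ?e (map f zs)) \<union> {?e..<d}"
      using Cons.prems by (intro Cons.IH) auto
    moreover have "y \<le> ?x" if "y \<in> set (strict_from d (map f (filter P zs)))" for y
      using that Cons.prems by (intro strict_from_le[of "map f (filter P zs)"]) auto
    ultimately show ?thesis using False by fastforce
  qed
qed simp

lemma strict_up_eq:
  assumes "\<forall>c \<in> set cs. c < d"
  shows "strict_up cs = strict_from d cs"
proof (cases cs)
  case (Cons a list)
  then have "min (d - 1) a = a" using assms by simp
  then show ?thesis using Cons by simp
qed simp

lemma str_B_plus_eq:
  assumes "sorted_wrt (\<ge>) lam"
  shows "str (B_plus lam \<alpha>) = map (\<lambda>r. rev (strict_from (int (part lam 1) + 1)
      (map (\<lambda>i. int (part lam i)) (key_column \<alpha> r)))) [1..<Suc (part (rearr \<alpha>) 1)]"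
proof -
  have "strict_up (map (\<lambda>i. int (part lam i)) (key_column \<alpha> r)) =
      strict_from (int (part lam 1) + 1) (map (\<lambda>i. int (part lam i)) (key_column \<alpha> r))" for r
    using part_decreasing[OF assms order_refl]
    by (intro strict_up_eq) (auto simp: set_key_column less_Suc_eq_le)
  then show ?thesis
    by (simp add: str_def B_plus_def key_tableau_def str_column_def rev_map del: upt_Suc)
qed

lemma nested_columns_key:
  fixes T :: "nat list list"
  assumes sorted: "\<And>r. r < length T \<Longrightarrow> sorted_wrt (<) (T ! r)"
    and nonempty: "\<And>r. r < length T \<Longrightarrow> T ! r \<noteq> []"
    and range: "\<And>r. r < length T \<Longrightarrow> set (T ! r) \<subseteq> {1..m}"
    and nested: "\<And>r s. r \<le> s \<Longrightarrow> s < length T \<Longrightarrow> set (T ! s) \<subseteq> set (T ! r)"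
  shows "\<exists>\<beta>. length \<beta> = m \<and> key_tableau \<beta> = T"
proof -
  define h where "h i = card {r. r < length T \<and> i \<in> set (T ! r)}" for i
  define \<beta> where "\<beta> = map h [1..<Suc m]"
  have len: "length \<beta> = m" by (simp add: \<beta>_def)
  have part_\<beta>: "part \<beta> i = (if i \<in> {1..m} then h i else 0)" for i
    by (auto simp: part_def \<beta>_def simp del: upt_Suc)
  have h_le: "h i \<le> length T" for i
    using card_mono[of "{..<length T}" "{r. r < length T \<and> i \<in> set (T ! r)}"]
    by (auto simp: h_def)
  have h_iff: "Suc r \<le> h i \<longleftrightarrow> i \<in> set (T ! r)" if "r < length T" for r i
  proof
    assume *: "i \<in> set (T ! r)"
    have "{..r} \<subseteq> {r. r < length T \<and> i \<in> set (T ! r)}"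
      using * nested[of _ r] that by auto
    from card_mono[OF _ this] show "Suc r \<le> h i" by (simp add: h_def)
  next
    assume *: "Suc r \<le> h i"
    show "i \<in> set (T ! r)"
    proof (rule ccontr)
      assume "i \<notin> set (T ! r)"
      then have "{r. r < length T \<and> i \<in> set (T ! r)} \<subseteq> {..<r}"
        using nested[of r] by (auto simp: not_less[symmetric] dest: leI)
      from card_mono[OF _ this] * show False by (simp add: h_def)
    qed
  qed
  have col: "key_column \<beta> (Suc r) = T ! r" if r: "r < length T" for r
  proof -
    have "set (key_column \<beta> (Suc r)) = set (T ! r)"
      using range[OF r] h_iff[OF r] by (auto simp: set_key_column len part_\<beta>)
    then show ?thesis
      using key_column_strict sorted[OF r] strict_sorted_equal by blast
  qed
  have "part (rearr \<beta>) 1 = length T"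
  proof (rule antisym)
    show "part (rearr \<beta>) 1 \<le> length T"
    proof (rule ccontr)
      assume "\<not> part (rearr \<beta>) 1 \<le> length T"
      then have "1 \<le> length (key_column \<beta> (Suc (length T)))"
        by (subst length_key_column_ge) auto
      then obtain i where "i \<in> set (key_column \<beta> (Suc (length T)))"
        by (cases "key_column \<beta> (Suc (length T))") auto
      then show False using h_le[of i] by (auto simp: set_key_column part_\<beta> split: if_splits)
    qed
    show "length T \<le> part (rearr \<beta>) 1"
    proof (cases "length T")
      case (Suc k)
      then have "1 \<le> length (key_column \<beta> (Suc k))"
        using col[of k] nonempty[of k] by (simp add: Suc_le_eq)
      then show ?thesis using Suc by (subst (asm) length_key_column_ge) auto
    qed simp
  qed
  then have "key_tableau \<beta> = T"
    using col by (intro nth_equalityI) (auto simp: key_tableau_def simp del: upt_Suc)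
  then show ?thesis using len by blast
qed

lemma comp_pow_well_defined:
  assumes lam: "sorted_wrt (\<ge>) lam"
    and pos: "\<forall>col \<in> set (str (B_plus lam \<alpha>)). \<forall>x \<in> set col. 0 < x"
  shows "\<exists>!\<beta>. length \<beta> = part lam 1 \<and> map (map int) (key_tableau \<beta>) = str (B_plus lam \<alpha>)"
proof -
  let ?S = "str (B_plus lam \<alpha>)"
  let ?d = "int (part lam 1) + 1"
  let ?f = "\<lambda>i. int (part lam i)"
  define T where "T = map (map nat) ?S"
  have lenS: "length ?S = part (rearr \<alpha>) 1"
    by (simp add: str_B_plus_eq[OF lam] del: upt_Suc)
  have S: "?S ! r = rev (strict_from ?d (map ?f (key_column \<alpha> (Suc r))))" if "r < length ?S" for r
    using that lenS by (simp add: str_B_plus_eq[OF lam] del: upt_Suc)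
  have posS: "0 < x" if "x \<in> set (?S ! r)" "r < length ?S" for r x
    using pos that nth_mem by blast
  have T: "T ! r = map nat (?S ! r)" if "r < length ?S" for r
    using that by (simp add: T_def)
  have lenT: "length T = length ?S" by (simp add: T_def)
  have int_T: "map (map int) T = ?S"
    using pos by (auto simp: T_def o_def intro!: map_idI less_imp_le)
  have sortedS: "sorted_wrt (<) (?S ! r)" if "r < length ?S" for r
    using strict_from_decreasing by (simp add: S[OF that] sorted_wrt_rev)
  have "\<exists>\<beta>. length \<beta> = part lam 1 \<and> key_tableau \<beta> = T"
  proof (rule nested_columns_key, unfold lenT)
    fix r assume r: "r < length ?S"
    show "sorted_wrt (<) (T ! r)"
      using sortedS[OF r] posS[OF _ r]
      by (auto simp: T[OF r] sorted_wrt_map intro: sorted_wrt_mono_rel[rotated])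
    have "1 \<le> length (key_column \<alpha> (Suc r))"
      using r lenS by (subst length_key_column_ge) auto
    then show "T ! r \<noteq> []"
      by (auto simp: T[OF r] S[OF r] length_strict_from simp flip: length_greater_0_conv)
    show "set (T ! r) \<subseteq> {1..part lam 1}"
    proof
      fix y assume "y \<in> set (T ! r)"
      then obtain x where x: "x \<in> set (?S ! r)" "y = nat x" by (auto simp: T[OF r])
      have "x < ?d" using x(1) by (auto simp: S[OF r] dest: strict_from_less)
      with posS[OF x(1) r] x(2) show "y \<in> {1..part lam 1}" by auto
    qed
  next
    fix r s assume rs: "r \<le> s" "s < length ?S"
    have "sorted_wrt (\<lambda>i j. ?f i \<ge> ?f j) (key_column \<alpha> (Suc r))"
      using key_column_strict[of \<alpha> "Suc r"]
      by (rule sorted_wrt_mono_rel[rotated])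
         (auto simp: set_key_column intro: part_decreasing[OF lam])
    then have "set (?S ! s) \<subseteq> set (?S ! r)"
      using rs strict_from_filter[of ?f "key_column \<alpha> (Suc r)" ?d ?d "\<lambda>i. Suc s \<le> part \<alpha> i"]
      by (simp add: S key_column_filter[of "Suc r" "Suc s"] sorted_wrt_map)
    then show "set (T ! s) \<subseteq> set (T ! r)" using rs by (auto simp: T)
  qed
  then obtain \<beta> where \<beta>: "length \<beta> = part lam 1" "key_tableau \<beta> = T" by blast
  show ?thesis
  proof (rule ex1I[of _ \<beta>])
    show "length \<beta> = part lam 1 \<and> map (map int) (key_tableau \<beta>) = ?S"
      using \<beta> int_T by simp
  next
    fix \<gamma> assume \<gamma>: "length \<gamma> = part lam 1 \<and> map (map int) (key_tableau \<gamma>) = ?S"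
    then have "map (map int) (key_tableau \<gamma>) = map (map int) (key_tableau \<beta>)"
      using \<beta> int_T by simp
    then have "key_tableau \<gamma> = key_tableau \<beta>"
      by (metis inj_mapI inj_map_eq_map inj_of_nat)
    then show "\<gamma> = \<beta>" using \<gamma> \<beta> by (intro key_tableau_inj) auto
  qed
qed

end

theory Submission
  imports Defs
begin

text \<open>
  Strictification only lowers entries, and an entry is lowered exactly as far as the entries below it
  force: the top entry of a column \<open>c\<^sub>1 \<ge> \<dots> \<ge> c\<^sub>k\<close>, read upwards, becomes the minimum of all
  \<open>c\<^sub>j - (k - j)\<close>. A strict column is positive as soon as its top entry is, so this minimum decides
  whether the column survives (lemma \<open>strict_from_positive_iff\<close>).

  Applied to the first column, whose entries are \<open>\<lambda>[i\<^sub>1] \<ge> \<dots> \<ge> \<lambda>[i\<^sub>c]\<close> from bottom to top, this gives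
  exactly the stated inequalities. The other columns add no condition: the columns of a key tableau
  are nested, and strictification preserves the nesting, so every entry of \<open>str (B_plus lam \<alpha>)\<close>
  already occurs in its first column (lemma \<open>comp_pow_exists_iff\<close>).
\<close>

text \<open>
  The bound \<open>d\<close> acts as one more entry below the column, whence the condition on its length; the
  assumption on \<open>d\<close> makes the equivalence hold for the empty column too.
\<close>

lemma strict_from_positive_iff:
  assumes "0 < d"
  shows "(\<forall>x \<in> set (strict_from d cs). 0 < x) \<longleftrightarrow>
    int (length cs) < d \<and> (\<forall>k < length cs. int (length cs - k) \<le> cs ! k)"
  using assms
proof (induction cs arbitrary: d)
  case (Cons c cs)
  let ?e = "min (d - 1) c"
  show ?case
  proof (cases "0 < ?e")
    case True
    have "(\<forall>x \<in> set (strict_from d (c # cs)). 0 < x) \<longleftrightarrow>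
        int (length cs) < ?e \<and> (\<forall>k < length cs. int (length cs - k) \<le> cs ! k)"
      using Cons.IH[OF True] True by simp
    then show ?thesis by (auto simp: All_less_Suc2)
  next
    case False
    then show ?thesis by (auto simp: All_less_Suc2)
  qed
qed simp

lemma set_key_column_1: "set (key_column \<alpha> 1) = supp \<alpha>"
  by (auto simp: set_key_column supp_def)

lemma supp_empty_iff: "supp \<alpha> = {} \<longleftrightarrow> \<alpha> = replicate (length \<alpha>) 0"
proof
  assume "supp \<alpha> = {}"
  then show "\<alpha> = replicate (length \<alpha>) 0"
    by (intro part_ext) (auto simp: supp_def part_def)
next
  assume "\<alpha> = replicate (length \<alpha>) 0"
  then have "x = 0" if "x \<in> set \<alpha>" for x
    using that by (metis in_set_replicate)
  then show "supp \<alpha> = {}" by (auto simp: supp_def part_def)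
qed

lemma rearr_first_zero_iff: "part (rearr \<alpha>) 1 = 0 \<longleftrightarrow> supp \<alpha> = {}"
  using length_key_column_ge[of 1 1 \<alpha>] set_key_column_1[of \<alpha>]
  by (cases "key_column \<alpha> 1") auto

lemma key_column_1_enumeration:
  assumes "strict_mono_on {1..c} i" "i ` {1..c} = supp \<alpha>"
  shows "key_column \<alpha> 1 = map i [1..<Suc c]"
proof (rule strict_sorted_equal)
  show "sorted_wrt (<) (key_column \<alpha> 1)" by (rule key_column_strict)
  have "sorted_wrt (<) [1..<Suc c]" by (rule sorted_wrt_upt)
  then show "sorted_wrt (<) (map i [1..<Suc c])"
    unfolding sorted_wrt_map
    by (rule sorted_wrt_mono_rel[rotated])
       (use assms(1) in \<open>auto simp: strict_mono_on_def simp del: upt_Suc\<close>)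
  have "set [1..<Suc c] = {1..c}" by auto
  then show "set (key_column \<alpha> 1) = set (map i [1..<Suc c])"
    using assms(2) by (simp only: set_map set_key_column_1)
qed

lemma comp_pow_zero:
  assumes "sorted_wrt (\<ge>) lam" "supp \<alpha> = {}"
  shows "comp_pow lam \<alpha> = Some (replicate (part lam 1) 0)"
proof -
  have empty: "str (B_plus lam \<gamma>) = []" "key_tableau \<gamma> = []" if "supp \<gamma> = {}" for \<gamma>
    using that by (simp_all add: str_def B_plus_def key_tableau_def rearr_first_zero_iff[THEN iffD2]
        del: One_nat_def upt_Suc)
  have "supp (replicate (part lam 1) 0) = {}"
    by (simp add: supp_empty_iff)
  then have "(THE \<beta>. length \<beta> = part lam 1 \<and>
      map (map int) (key_tableau \<beta>) = str (B_plus lam \<alpha>)) = replicate (part lam 1) 0"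
    using assms by (intro the1_equality comp_pow_well_defined) (simp_all add: empty)
  then show ?thesis by (simp add: comp_pow_def empty assms)
qed

text \<open>
  Only the first column matters: column \<open>r\<close> arises from it by deleting indices, and its
  strictification is a subset of that of the first column. Starting every column above the common
  bound \<open>\<lambda>\<^sub>1 + 1\<close>, which exceeds all entries and so changes none of them, makes the columns comparable.
\<close>

lemma comp_pow_exists_iff:
  assumes lam: "sorted_wrt (\<ge>) lam" and "supp \<alpha> \<noteq> {}"
  shows "comp_pow lam \<alpha> \<noteq> None \<longleftrightarrow>
    (\<forall>x \<in> set (strict_from (int (part lam 1) + 1)
       (map (\<lambda>i. int (part lam i)) (key_column \<alpha> 1))). 0 < x)"
proof -
  let ?S = "\<lambda>r. set (strict_from (int (part lam 1) + 1)
       (map (\<lambda>i. int (part lam i)) (key_column \<alpha> r)))"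
  let ?M = "part (rearr \<alpha>) 1"
  have M: "1 \<le> ?M"
    using assms(2) rearr_first_zero_iff[of \<alpha>] by simp
  have nested: "?S r \<subseteq> ?S 1" if "1 \<le> r" for r
  proof -
    have "sorted_wrt (\<lambda>i j. int (part lam i) \<ge> int (part lam j)) (key_column \<alpha> 1)"
      using key_column_strict[of \<alpha> 1]
      by (rule sorted_wrt_mono_rel[rotated])
         (auto simp: set_key_column intro: part_decreasing[OF lam])
    then show ?thesis
      using strict_from_filter[of "\<lambda>i. int (part lam i)" "key_column \<alpha> 1" _ _ "\<lambda>i. r \<le> part \<alpha> i",
          OF _ order_refl]
      by (simp add: key_column_filter[OF that] sorted_wrt_map)
  qed
  have "comp_pow lam \<alpha> \<noteq> None \<longleftrightarrow> (\<forall>r \<in> {1..?M}. \<forall>x \<in> ?S r. 0 < x)"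
    by (auto simp: comp_pow_def str_B_plus_eq[OF lam] simp del: upt_Suc)
  also have "\<dots> \<longleftrightarrow> (\<forall>x \<in> ?S 1. 0 < x)"
    using M nested by (meson atLeastAtMost_iff order_refl subsetD)
  finally show ?thesis .
qed

lemma comp_pow_exists_iff_inequalities:
  assumes lam: "sorted_wrt (\<ge>) lam" and "supp \<alpha> \<noteq> {}"
    and i: "strict_mono_on {1..c} i" "i ` {1..c} = supp \<alpha>"
  shows "comp_pow lam \<alpha> \<noteq> None \<longleftrightarrow> (\<forall>j \<in> {1..c}. c - j + 1 \<le> part lam (i j))"
proof -
  have c: "1 \<in> {1..c}" using assms(2) i(2) by (cases c) auto
  then have "i 1 \<in> supp \<alpha>" using i(2) by blast
  then have le: "part lam (i 1) \<le> part lam 1"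
    by (intro part_decreasing[OF lam]) (auto simp: supp_def)
  have nth: "map i [1..<Suc c] ! k = i (Suc k)" if "k < c" for k
    using that by (simp del: upt_Suc)
  have "comp_pow lam \<alpha> \<noteq> None \<longleftrightarrow>
      c \<le> part lam 1 \<and> (\<forall>k < c. c - k \<le> part lam (i (Suc k)))"
    unfolding comp_pow_exists_iff[OF assms(1,2)] key_column_1_enumeration[OF i]
    by (subst strict_from_positive_iff) (auto simp: nth simp del: upt_Suc)
  also have "(\<forall>k < c. c - k \<le> part lam (i (Suc k))) \<longleftrightarrow>
      (\<forall>j \<in> {1..c}. c - j + 1 \<le> part lam (i j))" (is "?L \<longleftrightarrow> ?R")
  proof
    assume L: ?L
    show ?R
    proof
      fix j assume j: "j \<in> {1..c}"
      then show "c - j + 1 \<le> part lam (i j)"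
        using L[rule_format, of "j - 1"] by (auto simp: Suc_diff_le)
    qed
  next
    assume R: ?R
    show ?L
    proof (intro allI impI)
      fix k assume "k < c"
      then show "c - k \<le> part lam (i (Suc k))"
        using R[rule_format, of "Suc k"] by auto
    qed
  qed
  \<comment> \<open>The length condition is implied by the inequality for \<open>j = 1\<close>, as \<open>\<lambda>[i\<^sub>1] \<le> \<lambda>\<^sub>1\<close>.\<close>
  finally show ?thesis using c le by fastforce
qed

theorem proposition42:
  fixes n m :: nat and lam \<alpha> :: "nat list"
  assumes "partition_of_length n lam"
    and "m = part lam 1"
    and "length \<alpha> = n"
  shows "(\<alpha> = replicate n 0 \<longrightarrow> comp_pow lam \<alpha> = Some (replicate m 0)) \<and>
    (\<forall>c i. \<alpha> \<noteq> replicate n 0 \<and> strict_mono_on {1..c} i \<and> i ` {1..c} = supp \<alpha> \<longrightarrow>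
      (comp_pow lam \<alpha> \<noteq> None \<longleftrightarrow> (\<forall>j\<in>{1..c}. part lam (i j) \<ge> c - j + 1)) \<and>
      (comp_pow lam \<alpha> \<noteq> None \<longleftrightarrow>
        Min ((\<lambda>j. int (part lam (i j)) - (int c - int j)) ` {1..c}) \<ge> 1))"
proof (intro conjI[of "_ \<longrightarrow> _"] allI impI)
  have lam: "sorted_wrt (\<ge>) lam"
    using assms(1) by (simp add: partition_of_length_def)
  show "comp_pow lam \<alpha> = Some (replicate m 0)" if "\<alpha> = replicate n 0"
    using comp_pow_zero[OF lam] that assms by (simp add: supp_empty_iff)
  fix c :: nat and i
  assume *: "\<alpha> \<noteq> replicate n 0 \<and> strict_mono_on {1..c} i \<and> i ` {1..c} = supp \<alpha>"
  then have ne: "supp \<alpha> \<noteq> {}"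
    using assms(3) by (simp add: supp_empty_iff)
  then have "{1..c} \<noteq> {}" using * by auto
  then have "Min ((\<lambda>j. int (part lam (i j)) - (int c - int j)) ` {1..c}) \<ge> 1 \<longleftrightarrow>
      (\<forall>j\<in>{1..c}. part lam (i j) \<ge> c - j + 1)"
    by (subst Min_ge_iff) (simp_all, intro ball_cong, auto)
  then show "(comp_pow lam \<alpha> \<noteq> None \<longleftrightarrow> (\<forall>j\<in>{1..c}. part lam (i j) \<ge> c - j + 1)) \<and>
      (comp_pow lam \<alpha> \<noteq> None \<longleftrightarrow>
        Min ((\<lambda>j. int (part lam (i j)) - (int c - int j)) ` {1..c}) \<ge> 1)"
    using comp_pow_exists_iff_inequalities[OF lam ne, of c i] * by blast
qed

end
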